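(* Let $-\infty<m<M<\infty$ with $[m,M]\subseteq\mathbb{R}_+=[0,\infty)$ and $m\le 1\le M$. Let $f$ be a $3$-convex function on an interval $I\subseteq\mathbb{R}$ whose interior contains $[m,M]$, and suppose $f$ is differentiable on $(m,M)$. Let $\boldsymbol{p}=(p_1,\dots,p_n)$ and $\boldsymbol{q}=(q_1,\dots,q_n)$ be probability distributions with $q_i>0$ and $p_i/q_i\in[m,M]$ for every $i=1,\dots,n$. Then $$(1-m)\left[\frac{f(M)-f(m)}{M-m}-\frac{f_+'(m)}{2}\right]-\frac{1}{2}\sum_{i=1}^n(p_i-mq_i)f'\!\left(\frac{p_i}{q_i}\right)$$ $$\le \frac{M-1}{M-m}f(m)+\frac{1-m}{M-m}f(M)-\tilde{D}_f(\boldsymbol{p},\boldsymbol{q})$$ $$\le \frac{1}{2}\sum_{i=1}^n(Mq_i-p_i)f'\!\left(\frac{p_i}{q_i}\right)-(M-1)\left[\frac{f(M)-f(m)}{M-m}-\frac{f_-'(M)}{2}\right].$$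
   Context: A probability distribution $\boldsymbol{p}=(p_1,\dots,p_n)$ has $p_i\in[0,1]$ and $\sum_{i=1}^n p_i=1$. The generalized $f$-divergence functional is $\tilde{D}_f(\boldsymbol{p},\boldsymbol{q})=\sum_{i=1}^n q_i f\!\left(\frac{p_i}{q_i}\right)$. Divided differences: for mutually distinct points $t_0,\dots,t_n$, $[t_i]f=f(t_i)$ and $[t_0,\dots,t_n]f=\dfrac{[t_1,\dots,t_n]f-[t_0,\dots,t_{n-1}]f}{t_n-t_0}$. A function $f$ on an interval $I$ is $3$-convex if $[t_0,t_1,t_2,t_3]f\ge 0$ for all choices of four distinct points $t_0,t_1,t_2,t_3\in I$. $f_+'$ and $f_-'$ denote the right and left derivatives; at the endpoints $m$ and $M$ the value of $f'$ is understood as $f_+'(m)$ and $f_-'(M)$, respectively. *)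

theory Defs
  imports "HOL-Analysis.Analysis"
begin

definition prob_distribution :: "nat \<Rightarrow> (nat \<Rightarrow> real) \<Rightarrow> bool" where
  "prob_distribution n p \<longleftrightarrow>
     (\<forall>i\<in>{1..n}. p i \<in> {0..1}) \<and> (\<Sum>i=1..n. p i) = 1"

definition f_divergence ::
    "nat \<Rightarrow> (real \<Rightarrow> real) \<Rightarrow> (nat \<Rightarrow> real) \<Rightarrow> (nat \<Rightarrow> real) \<Rightarrow> real" where
  "f_divergence n f p q = (\<Sum>i=1..n. q i * f (p i / q i))"

(* The divided difference at the points of a list. It is meaningful only for nonempty lists
   of distinct points: the value at the empty list is a dummy, and repeated points may lead to
   a division by zero. *)
fun divided_difference :: "(real \<Rightarrow> real) \<Rightarrow> real list \<Rightarrow> real" where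
  "divided_difference f [] = 0"
| "divided_difference f [t] = f t"
| "divided_difference f (t # s # ts) =
     (divided_difference f (s # ts) - divided_difference f (butlast (t # s # ts)))
       / (last (s # ts) - t)"

definition three_convex_on :: "real set \<Rightarrow> (real \<Rightarrow> real) \<Rightarrow> bool" where
  "three_convex_on I f \<longleftrightarrow>
     (\<forall>t0\<in>I. \<forall>t1\<in>I. \<forall>t2\<in>I. \<forall>t3\<in>I.
        distinct [t0, t1, t2, t3] \<longrightarrow> divided_difference f [t0, t1, t2, t3] \<ge> 0)"

definition right_deriv :: "(real \<Rightarrow> real) \<Rightarrow> real \<Rightarrow> real" where
  "right_deriv f x = (THE D. (f has_real_derivative D) (at_right x))"

definition left_deriv :: "(real \<Rightarrow> real) \<Rightarrow> real \<Rightarrow> real" where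
  "left_deriv f x = (THE D. (f has_real_derivative D) (at_left x))"

(* The derivative of f on {m..M}, with the one-sided derivatives at the endpoints. *)
definition deriv_on_interval :: "real \<Rightarrow> real \<Rightarrow> (real \<Rightarrow> real) \<Rightarrow> real \<Rightarrow> real" where
  "deriv_on_interval m M f x =
     (if x = m then right_deriv f m else if x = M then left_deriv f M else deriv f x)"

end

theory Submission
  imports Defs
begin

text \<open>
  With \<open>x = p i / q i\<close>, the middle term is the average, with weights \<open>q i\<close>, of the gap at \<open>x\<close>
  between the chord of \<open>f\<close> over \<open>[m, M]\<close> and \<open>f\<close> itself, because the average of the values \<open>x\<close>
  is \<open>1\<close>. Expanding the chord from \<open>m\<close> cancels its slope against the lower bound, and
  expanding it from \<open>M\<close> cancels its slope against the upper bound. What is left are the averages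
  (lemma \<open>f_divergence_trapezoid_bound\<close>) of the pointwise inequalities
  \<open>f x - f m \<le> (x - m) * (f' m + f' x) / 2\<close> and \<open>f M - f x \<le> (M - x) * (f' x + f' M) / 2\<close>.
  Both are instances of the statement that the trapezoidal rule overestimates the integral of
  the derivative of a 3-convex function. It comes from the definition of 3-convexity without any
  integration: the divided difference at the points \<open>a\<close>, \<open>a + h\<close>, \<open>b - h\<close>, \<open>b\<close> is nonnegative,
  and as \<open>h\<close> tends to \<open>0\<close> from above it converges to
  \<open>(f' a + f' b - 2 * (f b - f a) / (b - a)) / (b - a)^2\<close>
  (lemma \<open>three_convex_trapezoid\<close>). The nodes approach \<open>a\<close> from the right and \<open>b\<close> from the left,
  so \<open>f' a\<close> and \<open>f' b\<close> are one-sided derivatives here, as required at \<open>m\<close> and \<open>M\<close>.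

  The one-sided derivatives at \<open>m\<close> and \<open>M\<close> exist because these points are interior to \<open>I\<close>:
  the second divided difference of a 3-convex function is increasing in each node, so it has
  one-sided limits, and points of \<open>I\<close> on the opposite side of the limit point keep them finite
  (lemma \<open>three_convex_one_sided_derivatives\<close>).
\<close>

section \<open>One-sided derivatives of 3-convex functions\<close>

lemma three_convex_divided_difference_mono:
  fixes f :: "real \<Rightarrow> real"
  assumes f: "three_convex_on I f" and I: "a \<in> I" "z \<in> I" "x \<in> I" "y \<in> I"
    and ne: "a \<noteq> z" "x \<noteq> a" "x \<noteq> z" "y \<noteq> a" "y \<noteq> z" and le: "x \<le> y"
  shows "divided_difference f [x, a, z] \<le> divided_difference f [y, a, z]"
proof (cases "x = y")
  case False
  \<comment> \<open>With \<open>x\<close> and \<open>y\<close> as the outer nodes, the recursion itself is the difference quotient of the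
    second divided difference; putting \<open>y\<close> back in front uses that the order of nodes is immaterial.\<close>
  have "distinct [x, a, z, y]" using ne False by auto
  then have "0 \<le> divided_difference f [x, a, z, y]"
    using f I unfolding three_convex_on_def by blast
  also have "\<dots> = (divided_difference f [a, z, y] - divided_difference f [x, a, z]) / (y - x)"
    by simp
  finally have "divided_difference f [x, a, z] \<le> divided_difference f [a, z, y]"
    using False le by (simp add: zero_le_divide_iff)
  also have "divided_difference f [a, z, y] = divided_difference f [y, a, z]"
  proof -
    have "z - a \<noteq> 0" "a - y \<noteq> 0" "y - a \<noteq> 0" "y - z \<noteq> 0" "z - y \<noteq> 0"
      using ne by auto
    then show ?thesis by (simp add: divide_simps) (simp add: algebra_simps)
  qed
  finally show ?thesis .
qed simp

text \<open>
  Solving \<open>[x, a, z]f = ([a, z]f - [x, a]f) / (z - x)\<close> for the difference quotient \<open>[x, a]f\<close>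
  turns a limit of the second divided difference as \<open>x\<close> tends to \<open>a\<close> into a derivative at \<open>a\<close>.
\<close>

lemma has_derivative_if_divided_difference_tendsto:
  fixes f :: "real \<Rightarrow> real"
  assumes lim: "((\<lambda>x. divided_difference f [x, a, z]) \<longlongrightarrow> L) (at a within S)" and "a \<noteq> z"
  shows "(f has_real_derivative (f z - f a) / (z - a) - L * (z - a)) (at a within S)"
proof -
  have "((\<lambda>x. (f z - f a) / (z - a) - divided_difference f [x, a, z] * (z - x))
          \<longlongrightarrow> (f z - f a) / (z - a) - L * (z - a)) (at a within S)"
    by (intro tendsto_intros lim)
  moreover have "eventually (\<lambda>x. (f z - f a) / (z - a) - divided_difference f [x, a, z] * (z - x)
        = (f x - f a) / (x - a)) (at a within S)"
  proof -
    have "eventually (\<lambda>x. x \<noteq> a \<and> x \<noteq> z) (at a within S)"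
      using \<open>a \<noteq> z\<close> by (auto intro!: eventually_conj simp: eventually_neq_at_within)
    then show ?thesis
    proof eventually_elim
      case (elim x)
      then have "a - x \<noteq> 0" "x - a \<noteq> 0" "z - x \<noteq> 0" by auto
      then have "divided_difference f [x, a, z] * (z - x)
          = (f z - f a) / (z - a) - (f a - f x) / (a - x)"
        by simp
      moreover have "(f a - f x) / (a - x) = (f x - f a) / (x - a)"
        by (metis minus_diff_eq minus_divide_divide)
      ultimately show ?case by simp
    qed
  qed
  ultimately show ?thesis
    unfolding has_field_derivative_iff by (rule Lim_transform_eventually)
qed

text \<open>
  The second divided difference at \<open>x\<close>, \<open>a\<close> and a fixed \<open>z > a\<close> is increasing in \<open>x\<close>.
  As \<open>x\<close> approaches \<open>a\<close> from the right, its values are bounded below by the value at a point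
  \<open>y < a\<close>; as \<open>x\<close> approaches from the left, they are bounded above by the value at a point
  between \<open>a\<close> and \<open>z\<close>. An interior point \<open>a\<close> leaves room in \<open>I\<close> on both sides for these choices.
\<close>

lemma three_convex_one_sided_derivatives:
  fixes f :: "real \<Rightarrow> real"
  assumes f: "three_convex_on I f" and a: "a \<in> interior I"
  shows "\<exists>D. (f has_real_derivative D) (at_right a)"
    and "\<exists>D. (f has_real_derivative D) (at_left a)"
proof -
  obtain e where e: "e > 0" "ball a e \<subseteq> I"
    using a by (auto simp: mem_interior)
  have in_I: "x \<in> I" if "\<bar>x - a\<bar> < e" for x
    using e that by (auto simp: dist_real_def subset_iff abs_minus_commute)
  define z where "z = a + e / 2"
  define y where "y = a - e / 2"
  define w where "w = a + e / 4"
  define s where "s = (\<lambda>x. divided_difference f [x, a, z])"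
  have mono: "s x \<le> s x'"
    if "x \<le> x'" "\<bar>x - a\<bar> < e" "\<bar>x' - a\<bar> < e" "x \<notin> {a, z}" "x' \<notin> {a, z}" for x x'
    unfolding s_def
    by (rule three_convex_divided_difference_mono[OF f])
      (use that e in \<open>auto intro!: in_I simp: z_def\<close>)
  have "(s \<longlongrightarrow> Inf (s ` ({a<..} \<inter> {a<..<z}))) (at a within ({a<..} \<inter> {a<..<z}))"
    by (rule Lim_right_bound[where K = "s y"])
      (use e in \<open>auto intro!: mono simp: y_def z_def\<close>)
  moreover have "at a within ({a<..} \<inter> {a<..<z}) = at_right a"
    by (rule at_within_nhd[where S = "{..<z}"]) (use e in \<open>auto simp: z_def\<close>)
  ultimately have "(s \<longlongrightarrow> Inf (s ` ({a<..} \<inter> {a<..<z}))) (at_right a)"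
    by simp
  from has_derivative_if_divided_difference_tendsto[OF this[unfolded s_def]]
  show "\<exists>D. (f has_real_derivative D) (at_right a)"
    using e by (auto simp: z_def)
  have "(s \<longlongrightarrow> Sup (s ` ({..<a} \<inter> {y<..<a}))) (at a within ({..<a} \<inter> {y<..<a}))"
    by (rule Lim_left_bound[where K = "s w"])
      (use e in \<open>auto intro!: mono simp: y_def z_def w_def\<close>)
  moreover have "at a within ({..<a} \<inter> {y<..<a}) = at_left a"
    by (rule at_within_nhd[where S = "{y<..}"]) (use e in \<open>auto simp: y_def\<close>)
  ultimately have "(s \<longlongrightarrow> Sup (s ` ({..<a} \<inter> {y<..<a}))) (at_left a)"
    by simp
  from has_derivative_if_divided_difference_tendsto[OF this[unfolded s_def]]
  show "\<exists>D. (f has_real_derivative D) (at_left a)"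
    using e by (auto simp: z_def)
qed

lemma has_real_derivative_right_deriv:
  assumes "\<exists>D. (f has_real_derivative D) (at_right a)"
  shows "(f has_real_derivative right_deriv f a) (at_right a)"
  unfolding right_deriv_def
  by (rule theI') (use assms in \<open>auto simp: has_field_derivative_iff
    intro: tendsto_unique[OF trivial_limit_at_right_real]\<close>)

lemma has_real_derivative_left_deriv:
  assumes "\<exists>D. (f has_real_derivative D) (at_left a)"
  shows "(f has_real_derivative left_deriv f a) (at_left a)"
  unfolding left_deriv_def
  by (rule theI') (use assms in \<open>auto simp: has_field_derivative_iff
    intro: tendsto_unique[OF trivial_limit_at_left_real]\<close>)

section \<open>The trapezoid inequality\<close>

text \<open>
  The limit below is the divided difference with the double nodes \<open>a\<close>, \<open>a\<close>, \<open>b\<close>, \<open>b\<close>.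
  Pairing \<open>a\<close> with \<open>a + h\<close> and \<open>b - h\<close> with \<open>b\<close> makes the outer first-order differences
  converge to the two one-sided derivatives, and the inner one to the slope of the chord.
\<close>

lemma three_convex_trapezoid:
  fixes f :: "real \<Rightarrow> real"
  assumes f: "three_convex_on I f" and ab: "a < b" "{a..b} \<subseteq> I"
    and Da: "(f has_real_derivative Da) (at_right a)"
    and Db: "(f has_real_derivative Db) (at_left b)"
  shows "f b - f a \<le> (b - a) * (Da + Db) / 2"
proof -
  have right: "filterlim (\<lambda>h. a + h) (at_right a) (at_right 0)"
    by (auto simp: filterlim_at eventually_at_filter intro!: tendsto_eq_intros)
  have left: "filterlim (\<lambda>h. b - h) (at_left b) (at_right 0)"
    by (auto simp: filterlim_at eventually_at_filter intro!: tendsto_eq_intros)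
  have fa: "((\<lambda>h. f (a + h)) \<longlongrightarrow> f a) (at_right 0)"
    using DERIV_continuous[OF Da] unfolding continuous_within
    by (rule filterlim_compose[OF _ right])
  have fb: "((\<lambda>h. f (b - h)) \<longlongrightarrow> f b) (at_right 0)"
    using DERIV_continuous[OF Db] unfolding continuous_within
    by (rule filterlim_compose[OF _ left])
  have da: "((\<lambda>h. (f (a + h) - f a) / (a + h - a)) \<longlongrightarrow> Da) (at_right 0)"
    using Da unfolding has_field_derivative_iff by (rule filterlim_compose[OF _ right])
  have "((\<lambda>h. (f (b - h) - f b) / (b - h - b)) \<longlongrightarrow> Db) (at_right 0)"
    using Db unfolding has_field_derivative_iff by (rule filterlim_compose[OF _ left])
  moreover have "(\<lambda>h. (f (b - h) - f b) / (b - h - b)) = (\<lambda>h. (f b - f (b - h)) / (b - (b - h)))"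
    by (rule ext) (simp add: minus_divide_left)
  ultimately have db: "((\<lambda>h. (f b - f (b - h)) / (b - (b - h))) \<longlongrightarrow> Db) (at_right 0)"
    by simp
  define S where "S = (f b - f a) / (b - a)"
  have chord: "((\<lambda>h. (f (b - h) - f (a + h)) / (b - h - (a + h))) \<longlongrightarrow> S) (at_right 0)"
    unfolding S_def by (rule tendsto_eq_intros fa fb refl)+ (use ab in auto)
  have "((\<lambda>h. b - (a + h)) \<longlongrightarrow> b - a) (at_right 0)" "((\<lambda>h. b - h - a) \<longlongrightarrow> b - a) (at_right 0)"
    by (auto intro!: tendsto_eq_intros)
  from tendsto_divide[OF tendsto_diff[OF
      tendsto_divide[OF tendsto_diff[OF db chord] this(1)]
      tendsto_divide[OF tendsto_diff[OF chord da] this(2)]] tendsto_const[of "b - a"]]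
  have "((\<lambda>h. divided_difference f [a, a + h, b - h, b])
          \<longlongrightarrow> ((Db - S) / (b - a) - (S - Da) / (b - a)) / (b - a)) (at_right 0)"
    using ab by simp
  moreover have "eventually (\<lambda>h. 0 \<le> divided_difference f [a, a + h, b - h, b]) (at_right 0)"
  proof -
    have "eventually (\<lambda>h. h \<in> {0<..<(b - a) / 2}) (at_right 0)"
      using ab by (intro eventually_at_right_real) auto
    then show ?thesis
    proof eventually_elim
      case (elim h)
      have "{a, a + h, b - h, b} \<subseteq> {a..b}" using elim ab by (auto simp: field_simps)
      then have "a \<in> I" "a + h \<in> I" "b - h \<in> I" "b \<in> I" using ab(2) by blast+
      moreover have "distinct [a, a + h, b - h, b]" using elim ab by (auto simp: field_simps)
      ultimately show ?case using f unfolding three_convex_on_def by blast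
    qed
  qed
  ultimately have "0 \<le> ((Db - S) / (b - a) - (S - Da) / (b - a)) / (b - a)"
    by (intro tendsto_lowerbound) auto
  then have "0 \<le> (Db - S) - (S - Da)"
    using ab by (auto simp: zero_le_divide_iff mult_le_0_iff diff_divide_distrib[symmetric])
  then have "(b - a) * S \<le> (b - a) * ((Da + Db) / 2)"
    using ab by (intro mult_left_mono) auto
  then show ?thesis using ab by (simp add: S_def)
qed

lemma deriv_on_interval_has_one_sided_derivative:
  fixes f :: "real \<Rightarrow> real"
  assumes f: "three_convex_on I f" and mM: "m < M" "{m..M} \<subseteq> interior I"
    and diff: "\<forall>x\<in>{m<..<M}. f differentiable (at x)"
  shows "m \<le> x \<Longrightarrow> x < M \<Longrightarrow> (f has_real_derivative deriv_on_interval m M f x) (at_right x)"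
    and "m < x \<Longrightarrow> x \<le> M \<Longrightarrow> (f has_real_derivative deriv_on_interval m M f x) (at_left x)"
proof -
  have "m \<in> interior I" "M \<in> interior I" using mM by auto
  note ends = has_real_derivative_right_deriv[OF three_convex_one_sided_derivatives(1)[OF f this(1)]]
    has_real_derivative_left_deriv[OF three_convex_one_sided_derivatives(2)[OF f this(2)]]
  have "(f has_real_derivative deriv f x) (at x)" if "m < x" "x < M" for x
    using diff that by (metis DERIV_imp_deriv greaterThanLessThan_iff real_differentiable_def)
  note inner = this[THEN has_field_derivative_at_within]
  show "m \<le> x \<Longrightarrow> x < M \<Longrightarrow> (f has_real_derivative deriv_on_interval m M f x) (at_right x)"
    using ends(1) inner[of x] by (cases "x = m") (simp_all add: deriv_on_interval_def)
  show "m < x \<Longrightarrow> x \<le> M \<Longrightarrow> (f has_real_derivative deriv_on_interval m M f x) (at_left x)"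
    using ends(2) inner[of x] mM(1) by (cases "x = M") (simp_all add: deriv_on_interval_def)
qed

lemma three_convex_trapezoid_on_interval:
  fixes f :: "real \<Rightarrow> real"
  assumes f: "three_convex_on I f" and mM: "m < M" "{m..M} \<subseteq> interior I"
    and diff: "\<forall>x\<in>{m<..<M}. f differentiable (at x)" and ab: "m \<le> a" "a \<le> b" "b \<le> M"
  shows "f b - f a \<le> (b - a) * (deriv_on_interval m M f a + deriv_on_interval m M f b) / 2"
proof (cases "a = b")
  case False
  have "{a..b} \<subseteq> {m..M}" using ab by simp
  also have "\<dots> \<subseteq> I" using mM(2) interior_subset by blast
  finally show ?thesis
    using False ab
    by (intro three_convex_trapezoid[OF f] deriv_on_interval_has_one_sided_derivative[OF f mM diff])
      simp_all
qed simp

section \<open>Averaging over the distributions\<close>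

text \<open>
  The ratios \<open>p i / q i\<close> have mean \<open>1\<close> with respect to the weights \<open>q i\<close>, so averaging a pointwise
  bound that is affine in \<open>x\<close> up to the term with \<open>d x\<close> evaluates its affine part at \<open>1\<close>.
  With \<open>a = m\<close> this serves the lower estimate; with \<open>a = M\<close> and \<open>- f\<close>, \<open>- c\<close>, \<open>- d\<close> in place of
  \<open>f\<close>, \<open>c\<close>, \<open>d\<close> it serves the upper one.
\<close>

lemma f_divergence_trapezoid_bound:
  fixes f d :: "real \<Rightarrow> real"
  assumes p: "prob_distribution n p" and q: "prob_distribution n q" and pos: "\<forall>i\<in>{1..n}. q i > 0"
    and bound: "\<And>i. i \<in> {1..n} \<Longrightarrow>
      f (p i / q i) - f a \<le> (p i / q i - a) * (c + d (p i / q i)) / 2"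
  shows "f_divergence n f p q - f a
    \<le> (1 - a) * c / 2 + 1 / 2 * (\<Sum>i=1..n. (p i - a * q i) * d (p i / q i))"
proof -
  have sums: "(\<Sum>i=1..n. p i) = 1" "(\<Sum>i=1..n. q i) = 1"
    using p q by (simp_all add: prob_distribution_def)
  have "(\<Sum>i=1..n. q i * f (p i / q i) - q i * f a)
      \<le> (\<Sum>i=1..n. (p i - a * q i) * (c / 2) + 1 / 2 * ((p i - a * q i) * d (p i / q i)))"
  proof (rule sum_mono)
    fix i assume i: "i \<in> {1..n}"
    define x where "x = p i / q i"
    have qi: "q i > 0" using pos i by blast
    then have px: "p i = q i * x" by (simp add: x_def)
    have "q i * (f x - f a) \<le> q i * ((x - a) * (c + d x) / 2)"
      using bound[OF i] qi unfolding x_def by (intro mult_left_mono) simp_all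
    then show "q i * f (p i / q i) - q i * f a
        \<le> (p i - a * q i) * (c / 2) + 1 / 2 * ((p i - a * q i) * d (p i / q i))"
      unfolding x_def[symmetric] px by (simp add: algebra_simps add_divide_distrib diff_divide_distrib)
  qed
  also have "\<dots> = (1 - a) * (c / 2) + 1 / 2 * (\<Sum>i=1..n. (p i - a * q i) * d (p i / q i))"
    by (simp only: sum.distrib sum_subtractf sum_distrib_left[symmetric]
        sum_distrib_right[symmetric] sums mult_1_right)
  finally show ?thesis
    by (simp add: f_divergence_def sum_subtractf sum_distrib_right[symmetric] sums del: One_nat_def)
qed

text \<open>
  This is the chord of \<open>f\<close> over \<open>[m, M]\<close> at the mean \<open>1\<close> of the ratios. The expansion from \<open>m\<close>
  matches the slope term of the lower bound, the one from \<open>M\<close> that of the upper bound.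
\<close>

lemma chord_at_one:
  fixes m M :: real and f :: "real \<Rightarrow> real"
  assumes "m < M"
  shows "(M - 1) / (M - m) * f m + (1 - m) / (M - m) * f M = f m + (1 - m) * ((f M - f m) / (M - m))"
    and "(M - 1) / (M - m) * f m + (1 - m) / (M - m) * f M = f M - (M - 1) * ((f M - f m) / (M - m))"
proof -
  define s where "s = (f M - f m) / (M - m)"
  have fM: "f M = f m + (M - m) * s" using assms by (simp add: s_def)
  have "(M - 1) / (M - m) * f m + (1 - m) / (M - m) * f M
      = ((M - 1) * f m + (1 - m) * f M) / (M - m)"
    by (simp add: add_divide_distrib)
  also have "(M - 1) * f m + (1 - m) * f M = (f m + (1 - m) * s) * (M - m)"
    unfolding fM by (simp add: algebra_simps)
  also have "\<dots> / (M - m) = f m + (1 - m) * s" using assms by simp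
  finally have from_m: "(M - 1) / (M - m) * f m + (1 - m) / (M - m) * f M = f m + (1 - m) * s" .
  have "f m + (1 - m) * s = f M - (M - 1) * s" unfolding fM by (simp add: algebra_simps)
  note from_M = trans[OF from_m this]
  show "(M - 1) / (M - m) * f m + (1 - m) / (M - m) * f M = f m + (1 - m) * ((f M - f m) / (M - m))"
    and "(M - 1) / (M - m) * f m + (1 - m) / (M - m) * f M = f M - (M - 1) * ((f M - f m) / (M - m))"
    using from_m from_M by (simp_all only: s_def)
qed

theorem theorem3p1:
  fixes m M :: real and I :: "real set" and f :: "real \<Rightarrow> real"
    and n :: nat and p q :: "nat \<Rightarrow> real"
  assumes "m < M" and "{m..M} \<subseteq> {0..}" and "m \<le> 1" and "1 \<le> M"
    and "is_interval I" and "{m..M} \<subseteq> interior I"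
    and "three_convex_on I f"
    and "\<forall>x\<in>{m<..<M}. f differentiable (at x)"
    and "prob_distribution n p" and "prob_distribution n q"
    and "\<forall>i\<in>{1..n}. q i > 0"
    and "\<forall>i\<in>{1..n}. p i / q i \<in> {m..M}"
  shows "(1 - m) * ((f M - f m) / (M - m) - right_deriv f m / 2)
           - 1 / 2 * (\<Sum>i=1..n. (p i - m * q i) * deriv_on_interval m M f (p i / q i))
         \<le> (M - 1) / (M - m) * f m + (1 - m) / (M - m) * f M - f_divergence n f p q
       \<and> (M - 1) / (M - m) * f m + (1 - m) / (M - m) * f M - f_divergence n f p q
         \<le> 1 / 2 * (\<Sum>i=1..n. (M * q i - p i) * deriv_on_interval m M f (p i / q i))
           - (M - 1) * ((f M - f m) / (M - m) - left_deriv f M / 2)"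
proof -
  define d where "d = deriv_on_interval m M f"
  have d_ends: "d m = right_deriv f m" "d M = left_deriv f M"
    using assms(1) by (simp_all add: d_def deriv_on_interval_def)
  have x: "m \<le> p i / q i" "p i / q i \<le> M" if "i \<in> {1..n}" for i
    using assms(12) that by simp_all
  note trapezoid = three_convex_trapezoid_on_interval[OF assms(7,1,6,8), folded d_def]
  note average = f_divergence_trapezoid_bound[OF assms(9,10,11)]
  have "f_divergence n f p q - f m
      \<le> (1 - m) * d m / 2 + 1 / 2 * (\<Sum>i=1..n. (p i - m * q i) * d (p i / q i))"
    by (rule average, rule trapezoid) (use x assms(1) in simp_all)
  then have lower: "(1 - m) * (s - d m / 2) - 1 / 2 * (\<Sum>i=1..n. (p i - m * q i) * d (p i / q i))
      \<le> f m + (1 - m) * s - f_divergence n f p q" for s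
    by (simp add: right_diff_distrib)
  \<comment> \<open>The trapezoid inequality on \<open>[x, M]\<close> bounds \<open>f x\<close> from below, that is, \<open>- f x\<close> from above.\<close>
  have "f_divergence n (\<lambda>x. - f x) p q - (- f M)
      \<le> (1 - M) * (- d M) / 2 + 1 / 2 * (\<Sum>i=1..n. (p i - M * q i) * (- d (p i / q i)))"
  proof (rule average)
    fix i assume "i \<in> {1..n}"
    from trapezoid[OF x[OF this] order_refl]
    show "- f (p i / q i) - - f M \<le> (p i / q i - M) * (- d M + - d (p i / q i)) / 2"
      by (simp add: algebra_simps)
  qed
  moreover have "f_divergence n (\<lambda>x. - f x) p q = - f_divergence n f p q"
    by (simp add: f_divergence_def sum_negf)
  moreover have "(p i - M * q i) * (- d (p i / q i)) = (M * q i - p i) * d (p i / q i)" for i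
    by (simp add: left_diff_distrib)
  ultimately have "f M - f_divergence n f p q
      \<le> (M - 1) * d M / 2 + 1 / 2 * (\<Sum>i=1..n. (M * q i - p i) * d (p i / q i))"
    by (simp add: left_diff_distrib)
  then have upper: "f M - (M - 1) * s - f_divergence n f p q
      \<le> 1 / 2 * (\<Sum>i=1..n. (M * q i - p i) * d (p i / q i)) - (M - 1) * (s - d M / 2)" for s
    by (simp add: right_diff_distrib)
  show ?thesis
    unfolding d_def[symmetric] d_ends[symmetric]
    by (rule conjI, subst chord_at_one(1)[OF assms(1)], rule lower,
        subst chord_at_one(2)[OF assms(1)], rule upper)
qed

end
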